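(* Let $n$ be a positive multiple of $3$ and let $P$ be a set of $n$ points in the plane in general position. Suppose that for every integer $k$ with $0\le k<n/3$, the number $E_{\le k}(P)$ of $(\le k)$-edges of $P$ equals exactly $3\binom{k+2}{2}$. Then $P$ is $3$-decomposable.
   Context: For an $n$-point set $P$ in general position and $0\le k\le n/2-1$, a $k$-edge of $P$ is a line through two points of $P$ that leaves exactly $k$ points of $P$ on one of its sides; $E_k(P)$ denotes the number of $k$-edges, and $E_{\le k}(P)=\sum_{j=0}^{k}E_j(P)$ is the number of $(\le k)$-edges. A finite point set $P$ is $3$-decomposable if it can be partitioned into three sets $A,B,C$ of equal size such that there is a triangle $T$ enclosing $P$ for which the orthogonal projection of $P$ onto the three sides of $T$ shows $A$ between $B$ and $C$ on one side, $B$ between $C$ and $A$ on the second side, and $C$ between $A$ and $B$ on the third side. *)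

theory Defs
  imports "HOL-Analysis.Analysis"
begin

type_synonym point = "real \<times> real"

text \<open>Orientation determinant: positive iff r lies to the left of the directed line pq.\<close>
definition orient :: "point \<Rightarrow> point \<Rightarrow> point \<Rightarrow> real" where
  "orient p q r = (fst q - fst p) * (snd r - snd p) - (snd q - snd p) * (fst r - fst p)"

definition general_position :: "point set \<Rightarrow> bool" where
  "general_position P \<longleftrightarrow>
     (\<forall>p\<in>P. \<forall>q\<in>P. \<forall>r\<in>P. p \<noteq> q \<and> q \<noteq> r \<and> p \<noteq> r \<longrightarrow> orient p q r \<noteq> 0)"

definition k_edges :: "point set \<Rightarrow> nat \<Rightarrow> point set set" where
  "k_edges P k = {{p, q} | p q. p \<in> P \<and> q \<in> P \<and> p \<noteq> q \<and>
      (card {r \<in> P. orient p q r > 0} = k \<or> card {r \<in> P. orient p q r < 0} = k)}"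

definition E :: "point set \<Rightarrow> nat \<Rightarrow> nat" where
  "E P k = card (k_edges P k)"

definition E_le :: "point set \<Rightarrow> nat \<Rightarrow> nat" where
  "E_le P k = (\<Sum>j\<le>k. E P j)"

definition between_along :: "point \<Rightarrow> point set \<Rightarrow> point set \<Rightarrow> point set \<Rightarrow> bool" where
  "between_along d A B C \<longleftrightarrow>
     (\<forall>a\<in>A. \<forall>b\<in>B. \<forall>c\<in>C. b \<bullet> d < a \<bullet> d \<and> a \<bullet> d < c \<bullet> d) \<or>
     (\<forall>a\<in>A. \<forall>b\<in>B. \<forall>c\<in>C. c \<bullet> d < a \<bullet> d \<and> a \<bullet> d < b \<bullet> d)"

definition three_decomposable :: "point set \<Rightarrow> bool" where
  "three_decomposable P \<longleftrightarrow>
     (\<exists>A B C. A \<union> B \<union> C = P \<and> A \<inter> B = {} \<and> B \<inter> C = {} \<and> A \<inter> C = {} \<and>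
        card A = card B \<and> card B = card C \<and>
        (\<exists>t1 t2 t3 :: point. orient t1 t2 t3 \<noteq> 0 \<and> P \<subseteq> convex hull {t1, t2, t3} \<and>
            between_along (t2 - t1) A B C \<and>
            between_along (t3 - t2) B C A \<and>
            between_along (t1 - t3) C A B))"

end

theory Submission
  imports Defs
begin

text \<open>
  Write $n = 3m$. The hypothesis says that there are exactly $3(k+1)$ $k$-edges for every $k < m$.
  When a direction rotates once around the circle, the set of the first $k$ points in that direction
  changes exactly at $(k-1)$-edges. By induction on $k$, this cyclic sequence of $k$-sets is the one of a
  3-decomposable set: there are three classes of $k$ points, the first class is replaced by the second
  one point at a time, then the second by the third, and the third by the first. Indeed, between two
  consecutive changes of the $k$-set $S$ there must be a $k$-edge having exactly $S$ on one side, and at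
  least two of them if $S$ is one of the classes, since a single one would be an edge of the hull
  triangle. This already accounts for $3(k-1) + 3 \cdot 2 = 3(k+1)$ edges, so equality holds everywhere;
  the two edges at a class share the new point of that class.

  For $k = m$ all $m$-sets are known. Just before the first point of the second class enters, the
  first $m$ points are the first class, and the opposite $m$-set can then only be the third class.
\<close>

subsection \<open>Affine functionals and the sides of a line\<close>

definition affine_fun :: "(point \<Rightarrow> real) \<Rightarrow> bool" where
  "affine_fun f \<longleftrightarrow> (\<exists>d c. \<forall>x. f x = x \<bullet> d + c)"

lemma finite_obtain_min:
  fixes f :: "'a \<Rightarrow> real"
  assumes "finite A" "A \<noteq> {}"
  obtains x where "x \<in> A" "\<And>y. y \<in> A \<Longrightarrow> f x \<le> f y"
proof -
  have "Min (f ` A) \<in> f ` A" using assms by simp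
  then obtain x where "x \<in> A" "f x = Min (f ` A)" by auto
  then show ?thesis using that assms by simp
qed

lemma general_positionD:
  "general_position P \<Longrightarrow> x \<in> P \<Longrightarrow> y \<in> P \<Longrightarrow> z \<in> P \<Longrightarrow> x \<noteq> y \<Longrightarrow> z \<noteq> x \<Longrightarrow> z \<noteq> y \<Longrightarrow>
    orient x y z \<noteq> 0"
  unfolding general_position_def by metis

lemma affine_fun_comb:
  assumes "affine_fun f" "affine_fun g"
  shows "affine_fun (\<lambda>x. a * f x + b * g x + c)"
proof -
  obtain d1 c1 d2 c2 where "\<And>x. f x = x \<bullet> d1 + c1" "\<And>x. g x = x \<bullet> d2 + c2"
    using assms unfolding affine_fun_def by metis
  then have "a * f x + b * g x + c = x \<bullet> (a *\<^sub>R d1 + b *\<^sub>R d2) + (a * c1 + b * c2 + c)" for x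
    by (simp add: inner_right_distrib algebra_simps)
  then show ?thesis unfolding affine_fun_def by blast
qed

lemma affine_fun_inner: "affine_fun (\<lambda>x. x \<bullet> d + c)"
  unfolding affine_fun_def by blast

lemma affine_fun_orient: "affine_fun (\<lambda>z. orient x y z)"
proof -
  have "orient x y z = z \<bullet> (snd x - snd y, fst y - fst x) +
          ((snd y - snd x) * fst x - (fst y - fst x) * snd x)" for z
    by (cases z) (simp add: orient_def algebra_simps)
  then show ?thesis unfolding affine_fun_def by blast
qed

text \<open>Vanishing at both points makes the gradient \<open>d\<close> orthogonal to
  \<open>y - x\<close>, so it is \<open>l\<close> times the normal \<open>(- b, a)\<close>, which is
  the gradient of \<open>orient x y\<close>.\<close>

lemma affine_fun_vanish:
  assumes "affine_fun f" "f x = 0" "f y = 0" "x \<noteq> y"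
  obtains l where "\<And>z. f z = l * orient x y z"
proof -
  obtain d c where f: "\<And>z. f z = z \<bullet> d + c"
    using assms(1) unfolding affine_fun_def by metis
  define a where "a = fst y - fst x"
  define b where "b = snd y - snd x"
  define l where "l = (a * snd d - b * fst d) / (a\<^sup>2 + b\<^sup>2)"
  have nz: "a\<^sup>2 + b\<^sup>2 \<noteq> 0"
    using assms(4) by (auto simp: a_def b_def prod_eq_iff sum_power2_eq_zero_iff)
  have ab: "a * fst d + b * snd d = 0"
    using assms(2,3) by (simp add: f a_def b_def inner_prod_def algebra_simps)
  have "fst d * (a\<^sup>2 + b\<^sup>2) = a * (a * fst d + b * snd d) - b * (a * snd d - b * fst d)"
    by (simp add: power2_eq_square algebra_simps)
  then have d1: "fst d = - l * b"
    using nz by (simp add: l_def ab field_simps)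
  have "snd d * (a\<^sup>2 + b\<^sup>2) = b * (a * fst d + b * snd d) + a * (a * snd d - b * fst d)"
    by (simp add: power2_eq_square algebra_simps)
  then have d2: "snd d = l * a"
    using nz by (simp add: l_def ab field_simps)
  have "f z = l * orient x y z" for z
  proof -
    have "f z = f z - f x" using assms(2) by simp
    also have "\<dots> = (fst z - fst x) * fst d + (snd z - snd x) * snd d"
      by (simp add: f inner_prod_def algebra_simps)
    also have "\<dots> = l * orient x y z"
      by (simp add: d1 d2 orient_def a_def b_def algebra_simps)
    finally show ?thesis .
  qed
  then show ?thesis using that by blast
qed

text \<open>Stated with a functional instead of \<open>orient\<close>, so that swapping
  \<open>x\<close> and \<open>y\<close> changes nothing and \<open>S\<close> is always the negative
  side. The functional can be identically zero only if \<open>P = {x, y}\<close>.\<close>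

definition cut :: "point set \<Rightarrow> point \<Rightarrow> point \<Rightarrow> point set \<Rightarrow> bool" where
  "cut P x y S \<longleftrightarrow> x \<in> P \<and> y \<in> P \<and> x \<noteq> y \<and> S \<subseteq> P - {x, y} \<and>
     (\<exists>f. affine_fun f \<and> f x = 0 \<and> f y = 0 \<and> (\<forall>s\<in>S. f s < 0) \<and> (\<forall>q\<in>P - S - {x, y}. 0 < f q))"

lemma cut_sym: "cut P x y S \<longleftrightarrow> cut P y x S"
  unfolding cut_def by (auto simp: insert_commute)

lemma cut_sides:
  assumes "cut P x y S" "S \<noteq> P - {x, y} \<or> S \<noteq> {}"
  shows "S = {r \<in> P. orient x y r > 0} \<and> P - {x, y} - S = {r \<in> P. orient x y r < 0} \<or>
         S = {r \<in> P. orient x y r < 0} \<and> P - {x, y} - S = {r \<in> P. orient x y r > 0}"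
proof -
  have xy: "x \<in> P" "y \<in> P" "x \<noteq> y" "S \<subseteq> P - {x, y}" using assms(1) by (auto simp: cut_def)
  obtain f where f: "affine_fun f" "f x = 0" "f y = 0" "\<And>s. s \<in> S \<Longrightarrow> f s < 0"
    "\<And>q. q \<in> P - S - {x, y} \<Longrightarrow> 0 < f q"
    using assms(1) unfolding cut_def by metis
  obtain l where l: "\<And>z. f z = l * orient x y z"
    using affine_fun_vanish[OF f(1-3) xy(3)] by blast
  have o0: "orient x y x = 0" "orient x y y = 0" by (simp_all add: orient_def)
  have "l \<noteq> 0"
  proof
    assume "l = 0"
    then have "S = {}" "P - S - {x, y} = {}" using f(4,5) l by fastforce+
    then show False using assms(2) xy by auto
  qed
  then consider "l > 0" | "l < 0" by linarith
  then show ?thesis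
  proof cases
    case 1
    then have 2: "r \<in> S \<Longrightarrow> orient x y r < 0" "r \<in> P - S - {x, y} \<Longrightarrow> orient x y r > 0" for r
      using f(4,5)[of r] l[of r] 1 by (auto simp: mult_less_0_iff zero_less_mult_iff)
    have "S = {r \<in> P. orient x y r < 0}" "P - {x, y} - S = {r \<in> P. orient x y r > 0}"
      using xy o0 2 by (auto, (metis Diff_iff insertE empty_iff less_asym less_irrefl)+)
    then show ?thesis by blast
  next
    case 2
    then have 3: "r \<in> S \<Longrightarrow> orient x y r > 0" "r \<in> P - S - {x, y} \<Longrightarrow> orient x y r < 0" for r
      using f(4,5)[of r] l[of r] 2 by (auto simp: mult_less_0_iff zero_less_mult_iff)
    have "S = {r \<in> P. orient x y r > 0}" "P - {x, y} - S = {r \<in> P. orient x y r < 0}"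
      using xy o0 3 by (auto, (metis Diff_iff insertE empty_iff less_asym less_irrefl)+)
    then show ?thesis by blast
  qed
qed

text \<open>Each of \<open>S\<close> and \<open>S'\<close> is one of the two sides of the line. If
  different, they would be complementary and have \<open>card P - 2\<close> points together, which
  the size bound excludes.\<close>

lemma cut_unique:
  assumes "finite P" "cut P x y S" "cut P x y S'" "card S + card S' + 2 < card P"
  shows "S = S'"
proof -
  have xy: "x \<in> P" "y \<in> P" "x \<noteq> y" "S \<subseteq> P - {x, y}" "S' \<subseteq> P - {x, y}"
    using assms(2,3) by (auto simp: cut_def)
  have c: "card (P - {x, y}) + 2 = card P"
    using xy assms(1) card_Diff_subset[of "{x,y}" P] card_mono[of P "{x,y}"] by auto
  have "S \<noteq> P - {x, y}" "S' \<noteq> P - {x, y}" using c assms(4) by auto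
  from cut_sides[OF assms(2) disjI1[OF this(1)]] cut_sides[OF assms(3) disjI1[OF this(2)]]
  consider "S = S'" | "P - {x, y} - S = S'" by argo
  then show ?thesis
  proof cases
    case 2
    then have "card (P - {x, y}) = card S + card S'"
      using xy assms(1) by (metis Diff_partition Diff_disjoint card_Un_disjoint finite_Diff finite_subset)
    then show ?thesis using c assms(4) by linarith
  qed
qed

lemma cut_k_edge:
  assumes "cut P x y S" "finite P" "card P > 2"
  shows "{x, y} \<in> k_edges P (card S)"
proof -
  have xy: "x \<in> P" "y \<in> P" "x \<noteq> y" using assms(1) by (auto simp: cut_def)
  have "P - {x, y} \<noteq> {}"
    using assms(2,3) card_mono[of "{x,y}" P] xy by (auto simp: card_insert_if)
  then have "S \<noteq> P - {x, y} \<or> S \<noteq> {}" by auto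
  from cut_sides[OF assms(1) this]
  show ?thesis using xy unfolding k_edges_def by blast
qed

lemma affine_fun_nonvanish:
  assumes "general_position P" "affine_fun f" "x \<in> P" "y \<in> P" "x \<noteq> y" "f x = 0" "f y = 0"
    and "f z \<noteq> 0" "q \<in> P" "q \<noteq> x" "q \<noteq> y"
  shows "f q \<noteq> 0"
proof -
  obtain l where l: "\<And>z. f z = l * orient x y z"
    using affine_fun_vanish[OF assms(2,6,7,5)] by blast
  then have "l \<noteq> 0" using assms(8) by auto
  then show ?thesis using l general_positionD[OF assms(1,3,4,9,5,10,11)] by simp
qed

text \<open>Weak inequalities suffice: by general position, a functional that vanishes at
  \<open>x\<close> and \<open>y\<close> but not everywhere has no further zero in
  \<open>P\<close>.\<close>

lemma cutI:
  assumes "general_position P" "affine_fun f" "x \<in> P" "y \<in> P" "x \<noteq> y" "S \<subseteq> P - {x, y}"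
    and f: "f x = 0" "f y = 0" "\<And>s. s \<in> S \<Longrightarrow> f s \<le> 0" "\<And>q. q \<in> P - S \<Longrightarrow> 0 \<le> f q"
    and z: "f z \<noteq> 0"
  shows "cut P x y S"
proof -
  have nz: "f q \<noteq> 0" if "q \<in> P - {x, y}" for q
    using affine_fun_nonvanish[OF assms(1-5) f(1,2) z] that by blast
  have "f s < 0" if "s \<in> S" for s
    using f(3)[OF that] nz[of s] that assms(6) by force
  moreover have "0 < f q" if "q \<in> P - S - {x, y}" for q
    using f(4)[of q] nz[of q] that by force
  ultimately show ?thesis
    unfolding cut_def using assms(2-6) f(1,2) by blast
qed

section \<open>Finding edges by tilting and rotating a line\<close>

text \<open>Tilt \<open>g\<close> by adding a growing multiple of a second functional
  \<open>e\<close> until a point of \<open>T\<close> first ties with a point outside. At that moment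
  all other points are still weakly on their own side.\<close>

lemma cut_next:
  assumes gp: "general_position P" and fin: "finite P" and card: "card P > 2"
    and g: "affine_fun g" and T: "T \<subseteq> P" "T \<noteq> {}" "T \<noteq> P"
    and sep: "\<And>s q. s \<in> T \<Longrightarrow> q \<in> P - T \<Longrightarrow> g s < g q"
  obtains u w where "u \<in> T" "w \<in> P - T" "cut P u w (T - {u})"
proof -
  obtain s0 q0 where sq: "s0 \<in> T" "q0 \<in> P - T" using T by blast
  then have ne: "s0 \<noteq> q0" by auto
  have "P - {s0, q0} \<noteq> {}"
    using fin card card_mono[of "{s0,q0}" P] ne by (auto simp: card_insert_if)
  then obtain z where z: "z \<in> P" "z \<noteq> s0" "z \<noteq> q0" by auto
  have oz: "orient s0 q0 z \<noteq> 0"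
    using general_positionD[OF gp _ _ z(1) ne z(2,3)] sq T(1) by blast
  \<comment> \<open>With this sign \<open>e\<close> pushes \<open>z\<close> the wrong way past
    \<open>q0\<close> or \<open>s0\<close>, so a tie does occur.\<close>
  define k where "k = (if z \<in> T then sgn (orient s0 q0 z) else - sgn (orient s0 q0 z))"
  define e where "e x = k * orient s0 q0 x" for x
  have e0: "e s0 = 0" "e q0 = 0" by (simp_all add: e_def orient_def)
  have ez: "z \<in> T \<Longrightarrow> e z > 0" "z \<notin> T \<Longrightarrow> e z < 0"
    using oz by (auto simp: e_def k_def sgn_if mult_less_0_iff)
  \<comment> \<open>\<open>R\<close> holds the pairs whose order \<open>e\<close> reverses;
    \<open>t\<close> is the multiple of \<open>e\<close> at which such a pair ties.\<close>
  define R where "R = {(s, q). s \<in> T \<and> q \<in> P - T \<and> e q < e s}"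
  define t where "t = (\<lambda>(s, q). (g q - g s) / (e s - e q))"
  have finR: "finite R"
    by (rule finite_subset[of _ "P \<times> P"]) (use fin T R_def in auto)
  have "(z, q0) \<in> R \<or> (s0, z) \<in> R" using ez e0 z sq by (auto simp: R_def)
  then have "R \<noteq> {}" by auto
  then obtain r0 where r0: "r0 \<in> R" "\<And>r. r \<in> R \<Longrightarrow> t r0 \<le> t r"
    using finite_obtain_min[OF finR, of t] by metis
  obtain u w where "r0 = (u, w)" by (cases r0)
  with r0 have uw: "(u, w) \<in> R" "\<And>r. r \<in> R \<Longrightarrow> t (u, w) \<le> t r" by auto
  define c where "c = t (u, w)"
  define G where "G x = 1 * g x + c * e x + - (g u + c * e u)" for x
  have u: "u \<in> T" "w \<in> P - T" "e w < e u" using uw(1) by (auto simp: R_def)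
  have c: "c > 0" using sep[OF u(1,2)] u(3) by (simp add: c_def t_def)
  have Gu: "G u = 0" "G w = 0" using u(3) by (simp_all add: G_def c_def t_def field_simps)
  have mono: "G s \<le> G q" if "s \<in> T" "q \<in> P - T" for s q
  proof (cases "e q < e s")
    case True
    then have "c \<le> (g q - g s) / (e s - e q)"
      using uw(2)[of "(s, q)"] that by (simp add: R_def c_def t_def)
    then show ?thesis using True by (simp add: G_def field_simps)
  next
    case False
    then have "c * e s \<le> c * e q" using c by simp
    then show ?thesis using sep[OF that] by (simp add: G_def)
  qed
  \<comment> \<open>Since \<open>e\<close> vanishes at \<open>s0\<close> and \<open>q0\<close>,
    their gap under \<open>G\<close> is the one under \<open>g\<close>, so \<open>G\<close> is not
    identically zero.\<close>
  have "G s0 < G q0" using sep[OF sq] e0 by (simp add: G_def)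
  then obtain y where y: "G y \<noteq> 0" by (metis less_irrefl)
  have "affine_fun (\<lambda>x. k * orient s0 q0 x + 0 * orient s0 q0 x + 0)"
    by (intro affine_fun_comb affine_fun_orient)
  then have affe: "affine_fun e" by (simp add: e_def[abs_def])
  have aff: "affine_fun G"
    unfolding G_def by (rule affine_fun_comb[OF g affe])
  have "cut P u w (T - {u})"
  proof (rule cutI[OF gp aff _ _ _ _ Gu _ _ y])
    show "G s \<le> 0" if "s \<in> T - {u}" for s using mono[of s w] that u Gu by auto
    show "0 \<le> G q" if "q \<in> P - (T - {u})" for q using mono[of u q] that u Gu by auto
  qed (use u T in auto)
  then show ?thesis using that u by blast
qed

text \<open>Rotate the supporting line about \<open>w\<close>. Up to a positive factor,
  \<open>g x / f x\<close> is the cotangent of the angle at \<open>w\<close> between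
  \<open>u\<close> and \<open>x\<close>, so its minimum is attained at the point seen under the
  largest angle.\<close>

lemma cut_pencil:
  assumes gp: "general_position P" and fin: "finite P" and card: "card P > 2"
    and cut: "cut P u w {}"
  obtains r where "r \<noteq> u" "cut P w r {}"
proof -
  have uw: "u \<in> P" "w \<in> P" "u \<noteq> w" using cut by (auto simp: cut_def)
  obtain f where f: "affine_fun f" "f u = 0" "f w = 0" "\<And>q. q \<in> P - {u, w} \<Longrightarrow> 0 < f q"
    using cut unfolding cut_def by auto
  define g where "g x = x \<bullet> (u - w) + - (w \<bullet> (u - w))" for x
  have gu: "g u > 0" using uw(3) by (simp add: g_def flip: inner_diff_left)
  have "P - {u, w} \<noteq> {}"
    using fin card card_mono[of "{u,w}" P] uw by (auto simp: card_insert_if)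
  moreover have "finite (P - {u, w})" using fin by simp
  ultimately obtain r where r: "r \<in> P - {u, w}"
    "\<And>q. q \<in> P - {u, w} \<Longrightarrow> g r / f r \<le> g q / f q"
    using finite_obtain_min[of "P - {u, w}" "\<lambda>x. g x / f x"] by metis
  define h where "h x = f r * g x + - g r * f x + 0" for x
  have hu: "h u > 0" using gu f r by (simp add: h_def)
  have h0: "h w = 0" "h r = 0" using f by (simp_all add: h_def g_def algebra_simps)
  have "cut P w r {}"
  proof (rule cutI[OF gp _ _ _ _ _ h0, of _ u])
    show "affine_fun h"
      unfolding h_def g_def by (intro affine_fun_comb affine_fun_inner f)
    show "0 \<le> h q" if q: "q \<in> P - {}" for q
    proof (cases "q \<in> {u, w}")
      case True then show ?thesis using hu h0 by auto
    next
      case False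
      then show ?thesis using r(2)[of q] f(4)[of q] f(4)[OF r(1)] q by (simp add: h_def field_simps)
    qed
  qed (use uw r hu in auto)
  then show ?thesis using that r by blast
qed

subsection \<open>Edges met while rotating past a fixed set\<close>

text \<open>
  The functional \<open>g t\<close> rotates from \<open>f1\<close> to \<open>f2\<close>, and \<open>u\<close> is its minimum on \<open>P - S\<close> right after time \<open>t0\<close>.
  The point \<open>y\<close> is the first one to overtake \<open>u\<close>; it satisfies at \<open>t1\<close> the assumptions made on \<open>u\<close> at \<open>t0\<close>,
  so that the lemma can be iterated.
\<close>

lemma next_tie:
  fixes f1 f2 :: "point \<Rightarrow> real"
  defines "g \<equiv> \<lambda>t x. (1 - t) * f1 x + t * f2 x"
  assumes gp: "general_position P" and fin: "finite P"
    and aff: "affine_fun f1" "affine_fun f2" and S: "S \<subseteq> P" "v \<in> S"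
    and f1: "\<forall>s\<in>S. f1 s \<le> 0" "\<forall>q\<in>P - S. 0 \<le> f1 q"
    and f2: "\<forall>s\<in>S. f2 s \<le> 0" "\<forall>q\<in>P - S. q \<noteq> w \<longrightarrow> 0 < f2 q"
    and w: "w \<in> P - S" "f2 w = 0" and u: "u \<in> P - S" "u \<noteq> w"
    and t0: "0 \<le> t0" "t0 < 1"
    and min: "\<forall>q\<in>P - S. g t0 u \<le> g t0 q"
      "\<forall>q\<in>P - S. q \<noteq> u \<longrightarrow> g t0 u = g t0 q \<longrightarrow> f2 u < f2 q"
  obtains t1 y where "0 \<le> t1" "t1 < 1" "y \<in> P - S" "f2 y < f2 u" "cut P u y S"
    "\<forall>q\<in>P - S. g t1 y \<le> g t1 q"
    "\<forall>q\<in>P - S. q \<noteq> y \<longrightarrow> g t1 y = g t1 q \<longrightarrow> f2 y < f2 q"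
proof -
  \<comment> \<open>Only points that end below \<open>u\<close> can overtake it. \<open>a\<close> is
    the lead of \<open>u\<close> at \<open>t0\<close> and \<open>b\<close> its deficit at time 1; a
    linear lead is used up after the fraction \<open>a / (a + b)\<close> of the remaining
    time.\<close>
  define C where "C = {q \<in> P - S. f2 q < f2 u}"
  define a where "a q = g t0 q - g t0 u" for q
  define b where "b q = f2 u - f2 q" for q
  have "w \<in> C" using w f2(2) u by (simp add: C_def)
  moreover have "finite C" using fin by (simp add: C_def)
  ultimately obtain y where y: "y \<in> C" "\<And>q. q \<in> C \<Longrightarrow> a y / (a y + b y) \<le> a q / (a q + b q)"
    using finite_obtain_min[of C "\<lambda>q. a q / (a q + b q)"] by blast
  have ab: "a q > 0" "b q > 0" if "q \<in> C" for q
    using that min u by (force simp: C_def a_def b_def less_le)+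
  define r where "r = a y / (a y + b y)"
  have r: "0 < r" "r < 1" using ab[OF y(1)] by (auto simp: r_def field_simps)
  define t1 where "t1 = t0 + r * (1 - t0)"
  have "1 - t1 = (1 - r) * (1 - t0)" by (simp add: t1_def algebra_simps)
  then have "0 < 1 - t1" using r t0 by simp
  moreover have "0 < t1" using r t0 by (simp add: t1_def add_nonneg_pos)
  ultimately have t1: "0 < t1" "t1 < 1" by auto
  have gt: "g t1 q - g t1 u = (1 - r) * a q - r * b q" for q
    by (simp add: g_def a_def b_def t1_def algebra_simps)
  have le: "g t1 u \<le> g t1 q" if "q \<in> P - S" for q
  proof (cases "q \<in> C")
    case True
    then have "r \<le> a q / (a q + b q)" using y(2) by (simp add: r_def)
    then have "r * (a q + b q) \<le> a q" using ab[OF True] by (simp add: field_simps)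
    then show ?thesis using gt[of q] by (simp add: algebra_simps)
  next
    case False
    then have "0 \<le> (1 - r) * a q" "r * b q \<le> 0"
      using that min(1) r by (auto simp: C_def a_def b_def mult_le_0_iff)
    then show ?thesis using gt[of q] by linarith
  qed
  have tie: "g t1 y = g t1 u"
    using gt[of y] ab[OF y(1)] by (simp add: r_def field_simps)
  have yP: "y \<in> P - S" "f2 y < f2 u" using y(1) by (auto simp: C_def)
  have neg: "g t1 s \<le> 0" if "s \<in> S" for s
    using f1(1) f2(1) that t1 by (simp add: g_def add_nonpos_nonpos mult_nonneg_nonpos)
  have pos: "0 < g t1 u"
    using f1(2) f2(2) u t1 by (simp add: g_def add_nonneg_pos)
  define h where "h x = 1 * g t1 x + 0 * f2 x + - g t1 u" for x
  have h: "h u = 0" "h y = 0" using tie by (simp_all add: h_def)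
  have hv: "h v \<noteq> 0" using neg[OF S(2)] pos by (simp add: h_def)
  have "affine_fun (\<lambda>x. (1 - t1) * f1 x + t1 * f2 x + 0)" by (rule affine_fun_comb[OF aff])
  then have "affine_fun (g t1)" by (simp add: g_def)
  then have ah: "affine_fun h" unfolding h_def by (rule affine_fun_comb[OF _ aff(2)])
  have uy: "u \<in> P" "y \<in> P" "u \<noteq> y" using u yP by auto
  have "cut P u y S"
  proof (rule cutI[OF gp ah uy _ h _ _ hv])
    show "S \<subseteq> P - {u, y}" using S u yP by auto
    show "h s \<le> 0" if "s \<in> S" for s using neg[OF that] pos by (simp add: h_def)
    show "0 \<le> h q" if "q \<in> P - S" for q using le[OF that] by (simp add: h_def)
  qed
  \<comment> \<open>By general position only \<open>u\<close> and \<open>y\<close> are tied at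
    \<open>t1\<close>, and \<open>f2 y < f2 u\<close> puts \<open>y\<close> first
    afterwards.\<close>
  moreover have "f2 y < f2 q" if "q \<in> P - S" "q \<noteq> y" "g t1 y = g t1 q" for q
  proof (cases "q = u")
    case False
    then have "h q \<noteq> 0" using affine_fun_nonvanish[OF gp ah uy h hv] that by blast
    then show ?thesis using that tie by (simp add: h_def)
  qed (use yP in simp)
  ultimately show ?thesis using that[of t1 y] t1 yP le tie by simp
qed

text \<open>The first point outside \<open>S\<close> is \<open>u\<close> at the start of the
  rotation and \<open>w\<close> at its end, and each change of it is an edge with \<open>S\<close>
  on one side. The cases are one, two, or at least three changes; \<open>f2\<close> drops at each
  change, so no point recurs.\<close>

lemma gap_chain:
  assumes gp: "general_position P" and fin: "finite P"
    and cut: "cut P u v L1" "cut P u' w L2"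
    and S: "S = insert v L1" "S = insert u' L2" and uw: "u \<noteq> w"
  shows "cut P u w S \<or> (\<exists>y. y \<noteq> u \<and> y \<noteq> w \<and> cut P u y S \<and> cut P y w S) \<or>
         (\<exists>x y z. distinct [u, x, y, z] \<and> cut P u x S \<and> cut P x y S \<and> cut P y z S)"
proof -
  obtain f1 where f1: "affine_fun f1" "f1 u = 0" "f1 v = 0" "\<And>s. s \<in> L1 \<Longrightarrow> f1 s < 0"
    "\<And>q. q \<in> P - L1 - {u, v} \<Longrightarrow> 0 < f1 q"
    using cut(1) unfolding cut_def by metis
  obtain f2 where f2: "affine_fun f2" "f2 u' = 0" "f2 w = 0" "\<And>s. s \<in> L2 \<Longrightarrow> f2 s < 0"
    "\<And>q. q \<in> P - L2 - {u', w} \<Longrightarrow> 0 < f2 q"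
    using cut(2) unfolding cut_def by metis
  have SP: "S \<subseteq> P" "v \<in> S" "u \<in> P - S" using cut(1) S(1) by (auto simp: cut_def)
  have wP: "w \<in> P - S" using cut(2) S(2) by (auto simp: cut_def)
  have f1S: "\<And>s. s \<in> S \<Longrightarrow> f1 s \<le> 0" using f1(3,4) S(1) by (auto simp: less_imp_le)
  have f1p: "\<And>q. q \<in> P - S \<Longrightarrow> q \<noteq> u \<Longrightarrow> 0 < f1 q" using f1(5) S(1) by auto
  have f1P: "\<And>q. q \<in> P - S \<Longrightarrow> 0 \<le> f1 q" using f1p f1(2) by (metis less_imp_le order_refl)
  have f2S: "\<And>s. s \<in> S \<Longrightarrow> f2 s \<le> 0" using f2(2,4) S(2) by (auto simp: less_imp_le)
  have f2P: "\<And>q. q \<in> P - S \<Longrightarrow> q \<noteq> w \<Longrightarrow> 0 < f2 q" using f2(5) S(2) by auto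
  have objq: "\<forall>s\<in>S. f1 s \<le> 0" "\<forall>q\<in>P - S. 0 \<le> f1 q" "\<forall>s\<in>S. f2 s \<le> 0"
    "\<forall>q\<in>P - S. q \<noteq> w \<longrightarrow> 0 < f2 q"
    using f1S f1P f2S f2P by blast+
  note nt = next_tie[OF gp fin f1(1) f2(1) SP(1,2) objq wP f2(3)]
  obtain t1 x where x: "0 \<le> t1" "t1 < 1" "x \<in> P - S" "f2 x < f2 u" "cut P u x S"
    "\<forall>q\<in>P - S. (1 - t1) * f1 x + t1 * f2 x \<le> (1 - t1) * f1 q + t1 * f2 q"
    "\<forall>q\<in>P - S. q \<noteq> x \<longrightarrow> (1 - t1) * f1 x + t1 * f2 x = (1 - t1) * f1 q + t1 * f2 q \<longrightarrow> f2 x < f2 q"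
  proof (rule nt[of u 0])
    show "\<forall>q\<in>P - S. q \<noteq> u \<longrightarrow> (1 - 0) * f1 u + 0 * f2 u = (1 - 0) * f1 q + 0 * f2 q \<longrightarrow> f2 u < f2 q"
      using f1p f1(2) by fastforce
  qed (use SP uw f1P f1(2) in auto)
  show ?thesis
  proof (cases "x = w")
    case True then show ?thesis using x by simp
  next
    case xw: False
    obtain t2 y where y: "0 \<le> t2" "t2 < 1" "y \<in> P - S" "f2 y < f2 x" "cut P x y S"
      "\<forall>q\<in>P - S. (1 - t2) * f1 y + t2 * f2 y \<le> (1 - t2) * f1 q + t2 * f2 q"
      "\<forall>q\<in>P - S. q \<noteq> y \<longrightarrow> (1 - t2) * f1 y + t2 * f2 y = (1 - t2) * f1 q + t2 * f2 q \<longrightarrow> f2 y < f2 q"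
      by (rule nt[OF x(3) xw x(1,2,6,7)])
    show ?thesis
    proof (cases "y = w")
      case True
      then show ?thesis using x y xw by (intro disjI2 disjI1 exI[of _ x]) auto
    next
      case yw: False
      obtain z where z: "f2 z < f2 y" "cut P y z S"
        by (rule nt[OF y(3) yw y(1,2,6,7)])
      have "distinct [u, x, y, z]" using x(4) y(4) z(1) by auto
      then show ?thesis using x(5) y(5) z(2) by blast
    qed
  qed
qed

section \<open>Counting the edges that cut off a given set\<close>

definition separated_edges :: "point set \<Rightarrow> point set \<Rightarrow> point set set" where
  "separated_edges P S = {{x, y} | x y. cut P x y S}"

lemma cut_separated_edges: "cut P x y S \<Longrightarrow> {x, y} \<in> separated_edges P S"
  unfolding separated_edges_def by blast

lemma finite_separated_edges: "finite P \<Longrightarrow> finite (separated_edges P S)"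
  by (rule finite_subset[of _ "Pow P"]) (auto simp: separated_edges_def cut_def)

lemma separated_edges_subset:
  "finite P \<Longrightarrow> card P > 2 \<Longrightarrow> separated_edges P S \<subseteq> k_edges P (card S)"
  unfolding separated_edges_def using cut_k_edge by blast

lemma finite_k_edges: "finite P \<Longrightarrow> finite (k_edges P k)"
  by (rule finite_subset[of _ "Pow P"]) (auto simp: k_edges_def)

lemma separated_edges_disjoint:
  assumes "finite P" "card S + card S' + 2 < card P" "S \<noteq> S'"
  shows "separated_edges P S \<inter> separated_edges P S' = {}"
proof (rule ccontr)
  assume "separated_edges P S \<inter> separated_edges P S' \<noteq> {}"
  then obtain x y x' y' where "cut P x y S" "cut P x' y' S'" "{x, y} = {x', y'}"
    unfolding separated_edges_def by blast
  then have "cut P x y S \<and> cut P x y S'" using cut_sym by (metis doubleton_eq_iff)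
  then show False using cut_unique assms by blast
qed

text \<open>The equality cases are what the induction uses: if a bound is attained, the chain has a
  single step or passes through one middle point \<open>y\<close>, which becomes the new point of a
  class.\<close>

lemma gap_card:
  assumes gp: "general_position P" and fin: "finite P"
    and cut: "cut P u v L1" "cut P u' w L2"
    and S: "S = insert v L1" "S = insert u' L2" and uw: "u \<noteq> w"
  shows "1 \<le> card (separated_edges P S)"
    and "\<not> cut P u w S \<Longrightarrow> 2 \<le> card (separated_edges P S)"
    and "card (separated_edges P S) = 1 \<Longrightarrow> cut P u w S"
    and "card (separated_edges P S) = 2 \<Longrightarrow> \<not> cut P u w S \<Longrightarrow> \<exists>y. cut P u y S \<and> cut P y w S"
proof -
  note fs = finite_separated_edges[OF fin, of S]
  have c1: "1 \<le> card (separated_edges P S)" if "cut P u w S"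
    using cut_separated_edges[OF that] fs by (metis One_nat_def Suc_leI card_gt_0_iff empty_iff)
  have c2: "2 \<le> card (separated_edges P S)" if "y \<noteq> u" "y \<noteq> w" "cut P u y S" "cut P y w S" for y
  proof -
    have "card {{u, y}, {y, w}} = 2" using that uw by (auto simp: card_insert_if doubleton_eq_iff)
    then show ?thesis using card_mono[OF fs, of "{{u, y}, {y, w}}"] that cut_separated_edges by simp
  qed
  have c3: "3 \<le> card (separated_edges P S)"
    if "distinct [u, x, y, z]" "cut P u x S" "cut P x y S" "cut P y z S" for x y z
  proof -
    have "card {{u, x}, {x, y}, {y, z}} = 3"
      using that by (auto simp: card_insert_if doubleton_eq_iff)
    then show ?thesis
      using card_mono[OF fs, of "{{u, x}, {x, y}, {y, z}}"] that cut_separated_edges by simp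
  qed
  consider "cut P u w S" | y where "y \<noteq> u" "y \<noteq> w" "cut P u y S" "cut P y w S"
    | "3 \<le> card (separated_edges P S)"
    using gap_chain[OF assms] c3 by metis
  note cases = this
  show "1 \<le> card (separated_edges P S)" by (cases rule: cases) (use c1 c2 in force)+
  show "2 \<le> card (separated_edges P S)" if "\<not> cut P u w S"
    by (cases rule: cases) (use that c2 in force)+
  show "cut P u w S" if "card (separated_edges P S) = 1"
    by (cases rule: cases) (use that c2 in force)+
  show "\<exists>y. cut P u y S \<and> cut P y w S" if "card (separated_edges P S) = 2" "\<not> cut P u w S"
    by (cases rule: cases) (use that in auto)
qed

subsection \<open>The three classes\<close>

datatype color = Red | Green | Blue

fun nxt :: "color \<Rightarrow> color" where
  "nxt Red = Green" | "nxt Green = Blue" | "nxt Blue = Red"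

lemma nxt_cycle [simp]: "nxt (nxt (nxt c)) = c"
  by (cases c) auto

lemma nxt_neq [simp]: "nxt c \<noteq> c" "c \<noteq> nxt c" "nxt (nxt c) \<noteq> c" "c \<noteq> nxt (nxt c)"
  by (cases c; simp)+

lemma color_cases: "d = c \<or> d = nxt c \<or> d = nxt (nxt c)"
  by (cases c; cases d) auto

lemma UNIV_color: "(UNIV :: color set) = {Red, Green, Blue}"
  using color.exhaust by auto

instance color :: finite
  by standard (simp add: UNIV_color)

lemma card_UNIV_color: "card (UNIV :: color set) = 3"
  by (simp add: UNIV_color)

text \<open>
  The class of colour \<open>c\<close> enters the first \<open>k\<close> positions in the order \<open>p c 0, \<dots>, p c (k - 1)\<close> and is replaced in
  the opposite order by the class \<open>nxt c\<close>; the sets \<open>gap p k c j\<close> are the \<open>k\<close>-sets met during this replacement.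
\<close>

definition ladder :: "point set \<Rightarrow> nat \<Rightarrow> (color \<Rightarrow> nat \<Rightarrow> point) \<Rightarrow> bool" where
  "ladder P k p \<longleftrightarrow>
     (\<forall>c i d j. i < k \<longrightarrow> j < k \<longrightarrow> p c i = p d j \<longrightarrow> c = d \<and> i = j) \<and>
     (\<forall>c j l. j + l < k \<longrightarrow> cut P (p c j) (p (nxt c) l) (p c ` {..<j} \<union> p (nxt c) ` {..<l}))"

definition gap :: "(color \<Rightarrow> nat \<Rightarrow> point) \<Rightarrow> nat \<Rightarrow> color \<Rightarrow> nat \<Rightarrow> point set" where
  "gap p k c j = p c ` {..<k - j} \<union> p (nxt c) ` {..<j}"

lemma ladder_inj: "ladder P k p \<Longrightarrow> i < k \<Longrightarrow> j < k \<Longrightarrow> p c i = p d j \<longleftrightarrow> c = d \<and> i = j"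
  unfolding ladder_def by blast

lemma ladder_cut:
  "ladder P k p \<Longrightarrow> j + l < k \<Longrightarrow> cut P (p c j) (p (nxt c) l) (p c ` {..<j} \<union> p (nxt c) ` {..<l})"
  unfolding ladder_def by blast

lemma ladder_in: "ladder P k p \<Longrightarrow> i < k \<Longrightarrow> p c i \<in> P"
  using ladder_cut[of P k p i 0 c] by (simp add: cut_def)

lemma card_ladder_image:
  assumes "ladder P k p" "i \<le> k"
  shows "card (p c ` {..<i}) = i"
proof -
  have "inj_on (p c) {..<i}"
    using assms ladder_inj by (intro inj_onI) (metis lessThan_iff less_le_trans)
  then show ?thesis by (simp add: card_image)
qed

lemma card_ladder_Un:
  assumes "ladder P k p" "i \<le> k" "j \<le> k"
  shows "card (p c ` {..<i} \<union> p (nxt c) ` {..<j}) = i + j"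
proof -
  have "p c ` {..<i} \<inter> p (nxt c) ` {..<j} = {}"
    using ladder_inj[OF assms(1)] assms(2,3) by (fastforce dest: less_le_trans)
  then show ?thesis using card_ladder_image[OF assms(1)] assms by (simp add: card_Un_disjoint)
qed

lemma mem_gap:
  assumes "ladder P k p" "j < k" "i < k"
  shows "p d i \<in> gap p k c j \<longleftrightarrow> d = c \<and> i < k - j \<or> d = nxt c \<and> i < j"
proof -
  have "p d i \<in> p e ` {..<l} \<longleftrightarrow> d = e \<and> i < l" if "l \<le> k" for e l
    using ladder_inj[OF assms(1)] that assms(3) by (auto simp: image_iff)
  then show ?thesis using assms(2) by (simp add: gap_def)
qed

lemma card_gap: "ladder P k p \<Longrightarrow> j < k \<Longrightarrow> card (gap p k c j) = k"
  unfolding gap_def by (subst card_ladder_Un) auto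

text \<open>For \<open>j < k\<close> the point \<open>p c 0\<close> lies in
  \<open>gap p k c j\<close>, so two different colours with the same gap would be successors of each
  other. The range must stop before \<open>k\<close>, since \<open>gap p k c k\<close> is
  \<open>gap p k (nxt c) 0\<close>.\<close>

lemma gap_inj:
  assumes "ladder P k p" "j < k" "j' < k" "gap p k c j = gap p k c' j'"
  shows "c = c' \<and> j = j'"
proof
  have *: "d = c \<and> i < k - j \<or> d = nxt c \<and> i < j \<longleftrightarrow> d = c' \<and> i < k - j' \<or> d = nxt c' \<and> i < j'"
    if "i < k" for d i
    using mem_gap[OF assms(1,2) that, of d c] mem_gap[OF assms(1,3) that, of d c'] assms(4) by simp
  show "c = c'" using *[of 0 c] *[of 0 c'] assms(2,3) nxt_neq by (metis gr_zeroI less_nat_zero_code not_less_zero zero_less_diff)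
  then have "\<not> j < j'" "\<not> j' < j" using *[of j "nxt c"] *[of j' "nxt c"] assms(2,3) by auto
  then show "j = j'" by simp
qed

section \<open>The induction step: adding one point to each class\<close>

text \<open>The point \<open>p c l\<close> is the last to enter the class and the first to leave it,
  so both bounding edges cut off the same \<open>l\<close> points.\<close>

lemma ladder_gap_0:
  fixes c :: color
  assumes lad: "ladder P (Suc l) p"
  defines "S \<equiv> gap p (Suc l) c 0"
  shows "cut P (p (nxt (nxt c)) 0) (p c l) (p c ` {..<l})"
    "cut P (p c l) (p (nxt c) 0) (p c ` {..<l})"
    "S = insert (p c l) (p c ` {..<l})"
  using ladder_cut[OF lad, of 0 l "nxt (nxt c)"] ladder_cut[OF lad, of l 0 c]
  by (simp_all add: S_def gap_def lessThan_Suc)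

text \<open>On the way in, \<open>p (nxt c) i'\<close> replaces \<open>p c (Suc l)\<close>; on the
  way out, \<open>p (nxt c) i\<close> replaces \<open>p c l\<close>. So the chain of edges at this
  gap runs from \<open>p c (Suc l)\<close> to \<open>p (nxt c) i\<close>.\<close>

lemma ladder_gap_Suc:
  fixes c :: color
  assumes lad: "ladder P (Suc (l + i)) p"
  defines "S \<equiv> gap p (Suc (l + i)) c i"
  shows "cut P (p c l) (p (nxt c) i) (p c ` {..<l} \<union> p (nxt c) ` {..<i})"
    "S = insert (p c l) (p c ` {..<l} \<union> p (nxt c) ` {..<i})"
    "i = Suc i' \<Longrightarrow> cut P (p c (Suc l)) (p (nxt c) i') (p c ` {..<Suc l} \<union> p (nxt c) ` {..<i'})"
    "i = Suc i' \<Longrightarrow> S = insert (p (nxt c) i') (p c ` {..<Suc l} \<union> p (nxt c) ` {..<i'})"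
  using ladder_cut[OF lad, of l i c] ladder_cut[OF lad, of "Suc l" i' c]
  by (auto simp add: S_def gap_def lessThan_Suc Suc_diff_le)

text \<open>The \<open>3 * k\<close> gaps are distinct sets, so their separated edges are disjoint
  families of \<open>k\<close>-edges. The lower bounds already add up to the given number of
  \<open>k\<close>-edges; hence each bound is attained and the equality cases of
  \<open>gap_card\<close> apply.\<close>

lemma ladder_gap_edges:
  assumes gp: "general_position P" and fin: "finite P" and lad: "ladder P k p"
    and k: "2 * k + 2 < card P" and E: "card (k_edges P k) = 3 * (k + 1)" and k0: "0 < k"
  shows "\<exists>x. cut P (p (nxt (nxt c)) 0) x (gap p k c 0) \<and> cut P x (p (nxt c) 0) (gap p k c 0)"
    and "0 < j \<Longrightarrow> j < k \<Longrightarrow> cut P (p c (k - j)) (p (nxt c) j) (gap p k c j)"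
proof -
  let ?F = "\<lambda>(c, j). separated_edges P (gap p k c j)"
  let ?I = "(UNIV :: color set) \<times> {..<k}"
  \<comment> \<open>Two edges for a full class and one for any other gap:
    \<open>3 * 2 + 3 * (k - 1) = 3 * (k + 1)\<close>.\<close>
  define lb where "lb = (\<lambda>(c :: color, j :: nat). if j = 0 then 2 else 1 :: nat)"
  \<comment> \<open>These two points span an edge of the hull triangle. Its line cuts off the empty
    set, so by \<open>cut_unique\<close> it cannot cut off \<open>k\<close> points as well.\<close>
  have no: "\<not> cut P (p (nxt (nxt c)) 0) (p (nxt c) 0) (gap p k c 0)" for c
  proof
    assume a: "cut P (p (nxt (nxt c)) 0) (p (nxt c) 0) (gap p k c 0)"
    have b: "cut P (p (nxt (nxt c)) 0) (p (nxt c) 0) {}"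
      using ladder_cut[OF lad, of 0 0 "nxt c"] k0 by (simp add: cut_sym)
    have "gap p k c 0 = {}"
      by (rule cut_unique[OF fin a b]) (use card_gap[OF lad k0, of c] k in simp)
    then show False using card_gap[OF lad k0, of c] k0 by simp
  qed
  have gap0: "2 \<le> card (?F (c, 0))" "card (?F (c, 0)) = 2 \<Longrightarrow>
     \<exists>x. cut P (p (nxt (nxt c)) 0) x (gap p k c 0) \<and> cut P x (p (nxt c) 0) (gap p k c 0)" for c
  proof -
    obtain l where l: "k = Suc l" using k0 by (cases k) auto
    have lad': "ladder P (Suc l) p" using lad l by simp
    have "p (nxt (nxt c)) 0 \<noteq> p (nxt c) 0" using ladder_inj[OF lad] k0 by simp
    note g = gap_card[OF gp fin ladder_gap_0(1,2,3,3)[OF lad', of c] this]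
    show "2 \<le> card (?F (c, 0))" using g(2) no[of c] l by simp
    show "\<exists>x. cut P (p (nxt (nxt c)) 0) x (gap p k c 0) \<and> cut P x (p (nxt c) 0) (gap p k c 0)"
      if "card (?F (c, 0)) = 2"
      using g(4) no[of c] l that by simp
  qed
  have gapS: "1 \<le> card (?F (c, j))" 
    "card (?F (c, j)) = 1 \<Longrightarrow> cut P (p c (k - j)) (p (nxt c) j) (gap p k c j)"
    if j: "0 < j" "j < k" for c j
  proof -
    obtain i where i: "j = Suc i" using j by (cases j) auto
    define l where "l = k - Suc j"
    have l: "k = Suc (l + j)" "k - j = Suc l" using j by (auto simp: l_def)
    have lad': "ladder P (Suc (l + j)) p" using lad l by simp
    have "p c (Suc l) \<noteq> p (nxt c) j" using ladder_inj[OF lad] l i by simp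
    note g = gap_card[OF gp fin ladder_gap_Suc(3)[OF lad' i, of c] ladder_gap_Suc(1)[OF lad', of c]
      ladder_gap_Suc(4)[OF lad' i, of c] ladder_gap_Suc(2)[OF lad', of c] this]
    show "1 \<le> card (?F (c, j))" using g(1) l by simp
    show "cut P (p c (k - j)) (p (nxt c) j) (gap p k c j)" if "card (?F (c, j)) = 1"
      using g(3) l that by simp
  qed
  have lb: "lb r \<le> card (?F r)" if "r \<in> ?I" for r
    using that gap0(1) gapS(1) by (cases r) (auto simp: lb_def)
  have "sum lb ?I = (\<Sum>c\<in>(UNIV::color set). \<Sum>j<k. if j = 0 then 2 else 1)"
    unfolding lb_def by (rule sum.cartesian_product[symmetric])
  also have "(\<Sum>j<k. if j = 0 then 2 else 1 :: nat) = k + 1"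
    using k0 by (cases k) (simp_all add: sum.lessThan_Suc_shift del: sum.lessThan_Suc)
  finally have sum_lb: "sum lb ?I = 3 * (k + 1)" by (simp add: card_UNIV_color)
  have "(\<Sum>r\<in>?I. card (?F r)) = card (\<Union>r\<in>?I. ?F r)"
  proof (rule card_UN_disjoint[symmetric])
    show "\<forall>r\<in>?I. finite (?F r)" using finite_separated_edges[OF fin] by auto
    show "\<forall>r\<in>?I. \<forall>s\<in>?I. r \<noteq> s \<longrightarrow> ?F r \<inter> ?F s = {}"
    proof (intro ballI impI)
      fix r s assume rs: "r \<in> ?I" "s \<in> ?I" "r \<noteq> s"
      obtain c j d i where eq: "r = (c, j)" "s = (d, i)" by fastforce
      have "gap p k c j \<noteq> gap p k d i" using gap_inj[OF lad, of j i c d] rs eq by auto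
      then have "separated_edges P (gap p k c j) \<inter> separated_edges P (gap p k d i) = {}"
        using separated_edges_disjoint[OF fin] card_gap[OF lad] rs eq k by simp
      then show "?F r \<inter> ?F s = {}" using eq by simp
    qed
  qed simp
  also have "\<dots> \<le> card (k_edges P k)"
  proof (rule card_mono[OF finite_k_edges[OF fin]], rule UN_least)
    fix r assume "r \<in> ?I"
    then show "?F r \<subseteq> k_edges P k"
      using separated_edges_subset[OF fin, of "gap p k (fst r) (snd r)"] card_gap[OF lad] k
      by (cases r) auto
  qed
  finally have "(\<Sum>r\<in>?I. card (?F r)) \<le> sum lb ?I" using E sum_lb by simp
  moreover have "sum lb ?I \<le> (\<Sum>r\<in>?I. card (?F r))" by (rule sum_mono) (rule lb)
  ultimately have "sum lb ?I = (\<Sum>r\<in>?I. card (?F r))" by simp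
  then have eq: "lb r = card (?F r)" if "r \<in> ?I" for r
    using sum_mono_inv[of lb ?I "\<lambda>r. card (?F r)", OF _ lb that] by simp
  show "\<exists>x. cut P (p (nxt (nxt c)) 0) x (gap p k c 0) \<and> cut P x (p (nxt c) 0) (gap p k c 0)"
    using gap0(2)[of c] eq[of "(c, 0)"] k0 by (simp add: lb_def)
  show "cut P (p c (k - j)) (p (nxt c) j) (gap p k c j)" if "0 < j" "j < k"
    using gapS(2)[OF that, of c] eq[of "(c, j)"] that by (simp add: lb_def)
qed

lemma ladder_step:
  assumes gp: "general_position P" and fin: "finite P" and lad: "ladder P k p"
    and k: "2 * k + 2 < card P" and E: "card (k_edges P k) = 3 * (k + 1)" and k0: "0 < k"
  shows "\<exists>p. ladder P (Suc k) p"
proof -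
  note edges = ladder_gap_edges[OF assms]
  \<comment> \<open>\<open>x c\<close> is going to be the point of index \<open>k\<close> in class
    \<open>c\<close>.\<close>
  obtain x where x: "\<And>c. cut P (p (nxt (nxt c)) 0) (x c) (gap p k c 0)"
    "\<And>c. cut P (x c) (p (nxt c) 0) (gap p k c 0)"
    using edges(1) by metis
  have gap0: "gap p k c 0 = p c ` {..<k}" for c by (simp add: gap_def)
  have cg: "card (p c ` {..<i}) = i" if "i \<le> k" for c i
    by (rule card_ladder_image[OF lad that])
  have low: "cut P (p c i) (p (nxt c) 0) (p c ` {..<i})" "cut P (p (nxt (nxt c)) 0) (p c i) (p c ` {..<i})"
    if "i < k" for c i
    using ladder_cut[OF lad, of i 0 c] ladder_cut[OF lad, of 0 i "nxt (nxt c)"] that by simp_all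
  \<comment> \<open>\<open>x c\<close> avoids its own class because it lies off the set that it
    helps to cut off. If it were \<open>p d i\<close> in another class, one line through it and a
    first point \<open>p _ 0\<close> would cut off sets of sizes \<open>i\<close> and
    \<open>k\<close>.\<close>
  have new: "x c \<noteq> p d i" if i: "i < k" for c d i
  proof
    assume eq: "x c = p d i"
    consider "d = c" | "d = nxt c" | "d = nxt (nxt c)" using color_cases by blast
    then show False
    proof cases
      case 1
      have "x c \<notin> gap p k c 0" using x(1)[of c] by (auto simp: cut_def)
      then show ?thesis using 1 eq i by (auto simp: gap0)
    next
      case 2
      have "cut P (x c) (p (nxt (nxt c)) 0) (p (nxt c) ` {..<i})"
        using low(1)[OF i, of "nxt c"] eq 2 by simp
      moreover have "cut P (x c) (p (nxt (nxt c)) 0) (p c ` {..<k})"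
        using x(1)[of c] by (simp add: gap0 cut_sym)
      ultimately have "p (nxt c) ` {..<i} = p c ` {..<k}"
        by (rule cut_unique[OF fin]) (use cg i k in simp)
      then show ?thesis using cg[of i "nxt c"] cg[of k c] i by simp
    next
      case 3
      have "cut P (p (nxt c) 0) (x c) (p (nxt (nxt c)) ` {..<i})"
        using low(2)[OF i, of "nxt (nxt c)"] eq 3 by simp
      moreover have "cut P (p (nxt c) 0) (x c) (p c ` {..<k})"
        using x(2)[of c] by (simp add: gap0 cut_sym)
      ultimately have "p (nxt (nxt c)) ` {..<i} = p c ` {..<k}"
        by (rule cut_unique[OF fin]) (use cg i k in simp)
      then show ?thesis using cg[of i "nxt (nxt c)"] cg[of k c] i by simp
    qed
  qed
  have xn: "x c \<noteq> x (nxt c)" for c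
  proof
    assume eq: "x c = x (nxt c)"
    have "cut P (x c) (p (nxt (nxt c)) 0) (p c ` {..<k})"
      using x(1)[of c] by (simp add: gap0 cut_sym)
    moreover have "cut P (x c) (p (nxt (nxt c)) 0) (p (nxt c) ` {..<k})"
      using x(2)[of "nxt c"] eq by (simp add: gap0)
    ultimately have "p c ` {..<k} = p (nxt c) ` {..<k}"
      by (rule cut_unique[OF fin]) (use cg k in simp)
    moreover have "p c 0 \<in> p c ` {..<k}" using k0 by simp
    ultimately obtain i where "i < k" "p c 0 = p (nxt c) i" by auto
    then show False using ladder_inj[OF lad] k0 by simp
  qed
  have xinj: "x c = x d \<longleftrightarrow> c = d" for c d
    using color_cases[of d c] xn[of c] xn[of d] by auto
  define p' where "p' c i = (if i = k then x c else p c i)" for c i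
  have im: "p' c ` {..<i} = p c ` {..<i}" if "i \<le> k" for c i
    using that by (intro image_cong) (auto simp: p'_def)
  have "ladder P (Suc k) p'"
    unfolding ladder_def
  proof (intro conjI allI impI, goal_cases)
    case (1 c i d j) then show ?case
      using xinj new[of j c d] new[of i d c] ladder_inj[OF lad, of i j c d]
      by (auto simp: p'_def less_Suc_eq split: if_splits)
  next
    case (2 c i d j) then show ?case
      using xinj new[of j c d] new[of i d c] ladder_inj[OF lad, of i j c d]
      by (auto simp: p'_def less_Suc_eq split: if_splits)
  next
    case (3 c j l)
    \<comment> \<open>Respectively: the old edges, the two edges at a full class (with the new point
      at either end), and the single edges at the remaining gaps.\<close>
    then consider "j + l < k" | "l = 0" "j = k" | "j = 0" "l = k" "0 < l" | "0 < l" "l < k" "j = k - l"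
      by linarith
    then show ?case
    proof cases
      case 1
      then have "j < k" "l < k" by auto
      then show ?thesis using ladder_cut[OF lad 1, of c] by (simp add: im p'_def)
    next
      case 2
      then show ?thesis using x(2)[of c] k0 im[of k c] by (simp add: gap0 p'_def)
    next
      case 3
      then show ?thesis using x(1)[of "nxt c"] k0 im[of k "nxt c"] by (simp add: gap0 p'_def)
    next
      case 4
      then have "k - l \<noteq> k" by simp
      with 4 show ?thesis using edges(2)[OF 4(1,2), of c] im[of j c] im[of l "nxt c"]
        by (simp add: p'_def gap_def)
    qed
  qed
  then show ?thesis by blast
qed

section \<open>Generic directions\<close>

lemma injective_direction:
  fixes P :: "point set"
  assumes "finite P"
  obtains d where "inj_on (\<lambda>x. x \<bullet> d) P"
proof -
  \<comment> \<open>A pair with different second coordinates is tied by \<open>(1, s)\<close> for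
    just one \<open>s\<close>, collected in \<open>B\<close>. Pairs with equal second coordinates
    only add the value 0 of division by zero; if distinct, they are told apart by the first
    coordinate.\<close>
  define B where "B = (\<lambda>(x, y). - (fst x - fst y) / (snd x - snd y)) ` (P \<times> P)"
  have "finite B" using assms by (simp add: B_def)
  then obtain s where s: "s \<notin> B" using ex_new_if_finite[OF infinite_UNIV_char_0] by blast
  have "inj_on (\<lambda>x. x \<bullet> (1, s)) P"
  proof (rule inj_onI)
    fix x y assume xy: "x \<in> P" "y \<in> P" "x \<bullet> (1, s) = y \<bullet> (1, s)"
    have "- (fst x - fst y) / (snd x - snd y) \<in> B"
      unfolding B_def using xy by (intro image_eqI[of _ _ "(x, y)"]) auto
    then have "s \<noteq> - (fst x - fst y) / (snd x - snd y)" using s by blast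
    moreover have eq: "s * (snd x - snd y) = - (fst x - fst y)"
      using xy(3) by (simp add: inner_prod_def algebra_simps)
    ultimately have "snd x = snd y" using nonzero_eq_divide_eq by (metis eq_iff_diff_eq_0)
    with eq show "x = y" by (simp add: prod_eq_iff)
  qed
  then show ?thesis using that by blast
qed

text \<open>Keeps the strict order given by \<open>f\<close> while leaving \<open>h\<close> free to
  break its ties.\<close>

lemma generic_perturbation:
  fixes f h :: "'a \<Rightarrow> real"
  assumes "finite P"
  obtains e where "0 < e" "\<And>x y. x \<in> P \<Longrightarrow> y \<in> P \<Longrightarrow> f x < f y \<Longrightarrow> f x + e * h x < f y + e * h y"
proof -
  have *: "\<forall>\<^sub>F e in at_right 0. f x < f y \<longrightarrow> f x + e * h x < f y + e * h y" for x y
  proof (cases "f x < f y")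
    case True
    have "((\<lambda>e. (f y + e * h y) - (f x + e * h x)) \<longlongrightarrow> (f y + 0 * h y) - (f x + 0 * h x)) (at_right 0)"
      by (intro tendsto_intros)
    then have "\<forall>\<^sub>F e in at_right 0. 0 < (f y + e * h y) - (f x + e * h x)"
      using True by (intro order_tendstoD(1)) auto
    then show ?thesis by (rule eventually_mono) simp
  qed simp
  have "\<forall>\<^sub>F e in at_right (0::real). \<forall>x\<in>P. \<forall>y\<in>P. f x < f y \<longrightarrow> f x + e * h x < f y + e * h y"
    by (intro eventually_ball_finite ballI assms *)
  then have "\<forall>\<^sub>F e in at_right (0::real). 0 < e \<and>
      (\<forall>x\<in>P. \<forall>y\<in>P. f x < f y \<longrightarrow> f x + e * h x < f y + e * h y)"
    using eventually_at_right_less[of 0] by (rule eventually_conj[rotated])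
  then show ?thesis using eventually_happens[of _ "at_right (0::real)"] that by force
qed

lemma top_subset:
  fixes g :: "'a \<Rightarrow> real"
  assumes "finite P" "inj_on g P" "m \<le> card P"
  shows "\<exists>T\<subseteq>P. card T = m \<and> (\<forall>s\<in>T. \<forall>q\<in>P - T. g q < g s)"
  using assms(3)
proof (induction m)
  case 0
  then show ?case by (intro exI[of _ "{}"]) auto
next
  case (Suc m)
  then obtain T where T: "T \<subseteq> P" "card T = m" "\<forall>s\<in>T. \<forall>q\<in>P - T. g q < g s" by auto
  then have "P - T \<noteq> {}" "finite (P - T)" using Suc(2) assms(1) by auto
  then obtain z where z: "z \<in> P - T" "\<And>q. q \<in> P - T \<Longrightarrow> - g z \<le> - g q"
    using finite_obtain_min[of "P - T" "\<lambda>x. - g x"] by metis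
  have "g q < g z" if "q \<in> P - insert z T" for q
    using z(2)[of q] z(1) that assms(2) by (metis Diff_iff inj_onD insertI1 insertI2 less_le neg_le_iff_le)
  moreover have "card (insert z T) = Suc m"
    using T z assms(1) by (simp add: finite_subset)
  ultimately show ?case using T z by (intro exI[of _ "insert z T"]) auto
qed

section \<open>The hull triangle and the induction on \<open>k\<close>\<close>

text \<open>Walking along the hull from \<open>{u, w}\<close> in both directions gives
  \<open>{w, r}\<close> and \<open>{u, r'}\<close>. If \<open>r\<close> and \<open>r'\<close>
  differed, these would be all three hull edges, yet the walk continues from \<open>r\<close> along
  a fourth.\<close>

lemma ladder_base:
  assumes gp: "general_position P" and fin: "finite P" and card: "card P > 2"
    and E: "card (k_edges P 0) = 3"
  shows "\<exists>p. ladder P (Suc 0) p"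
proof -
  obtain d where d: "inj_on (\<lambda>x. x \<bullet> d) P" using injective_direction[OF fin] .
  have "P \<noteq> {}" using card by auto
  then obtain u where u: "u \<in> P" "\<And>q. q \<in> P \<Longrightarrow> u \<bullet> d \<le> q \<bullet> d"
    using finite_obtain_min[OF fin, of "\<lambda>x. x \<bullet> d"] by metis
  have lt: "u \<bullet> d < q \<bullet> d" if "q \<in> P - {u}" for q
    using u that inj_onD[OF d, of u q] by (fastforce simp: less_le)
  have "{u} \<noteq> P" using card by auto
  then obtain u' w where "u' \<in> {u}" "w \<in> P - {u}" "cut P u' w ({u} - {u'})"
    by (rule cut_next[OF gp fin card affine_fun_inner[of d 0], of "{u}", rotated 2])
      (use lt u in auto)
  then have w: "cut P u w {}" by simp
  obtain r where r: "r \<noteq> u" "cut P w r {}" using cut_pencil[OF gp fin card w] .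
  have "cut P w u {}" using w by (simp add: cut_sym)
  then obtain r' where r': "r' \<noteq> w" "cut P u r' {}" using cut_pencil[OF gp fin card] by metis
  obtain r'' where r'': "r'' \<noteq> w" "cut P r r'' {}" using cut_pencil[OF gp fin card r(2)] .
  have mem: "{x, y} \<in> k_edges P 0" if "cut P x y {}" for x y
    using cut_k_edge[OF that fin card] by simp
  have ne: "u \<noteq> w" "w \<noteq> r" "u \<noteq> r'" using w r r' by (auto simp: cut_def)
  have "r = r'"
  proof (rule ccontr)
    assume rr: "r \<noteq> r'"
    have "card {{u, w}, {w, r}, {u, r'}} = 3"
      using ne r r' rr by (auto simp: card_insert_if doubleton_eq_iff)
    then have "{{u, w}, {w, r}, {u, r'}} = k_edges P 0"
      using E mem w r r' by (intro card_subset_eq[OF finite_k_edges[OF fin]]) auto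
    then have "{r, r''} \<in> {{u, w}, {w, r}, {u, r'}}" using mem[OF r''(2)] by simp
    then show False using r r'' ne rr by (auto simp: doubleton_eq_iff)
  qed
  then have "cut P r u {}" using r' by (simp add: cut_sym)
  define p where "p c (i :: nat) = (case c of Red \<Rightarrow> u | Green \<Rightarrow> w | Blue \<Rightarrow> r)" for c i
  have "cut P (p c 0) (p (nxt c) 0) {}" for c
    using w r(2) \<open>cut P r u {}\<close> by (cases c) (auto simp: p_def)
  moreover have "p c 0 = p d 0 \<Longrightarrow> c = d" for c d
    using ne r(1) by (cases c; cases d) (auto simp: p_def)
  ultimately have "ladder P (Suc 0) p" unfolding ladder_def by auto
  then show ?thesis by blast
qed

lemma ladder_exists:
  assumes gp: "general_position P" and fin: "finite P" and card: "card P = 3 * m"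
    and E: "\<And>k. k < m \<Longrightarrow> card (k_edges P k) = 3 * (k + 1)" and m: "0 < m"
  shows "\<exists>p. ladder P m p"
proof -
  have "k < m \<Longrightarrow> \<exists>p. ladder P (Suc k) p" for k
  proof (induction k)
    case 0
    then show ?case using ladder_base[OF gp fin] card E[of 0] by simp
  next
    case (Suc k)
    then obtain p where "ladder P (Suc k) p" by auto
    then show ?case using ladder_step[OF gp fin, of "Suc k" p] E[of "Suc k"] Suc(2) card by simp
  qed
  then show ?thesis using m by (cases m) auto
qed

section \<open>The sets of \<open>m\<close> extreme points and the three directions\<close>

text \<open>Tilting \<open>g\<close> yields an edge \<open>{u, w}\<close> that cuts off the
  \<open>m - 1\<close> points of \<open>T - {u}\<close>. The \<open>3 * m\<close> ladder edges with
  \<open>j + l = m - 1\<close> exhaust the edges of this kind, so \<open>T\<close> is the set cut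
  off by one of them together with one of its endpoints.\<close>

lemma ladder_level_set:
  assumes gp: "general_position P" and fin: "finite P" and card: "card P = 3 * m"
    and lad: "ladder P m p" and E: "card (k_edges P (m - 1)) = 3 * m" and m: "0 < m"
    and g: "affine_fun g" and T: "T \<subseteq> P" "card T = m"
    and sep: "\<And>s q. s \<in> T \<Longrightarrow> q \<in> P - T \<Longrightarrow> g s < g q"
  obtains c j l where "j + l = m" "T = p c ` {..<j} \<union> p (nxt c) ` {..<l}"
proof -
  have c2: "card P > 2" "T \<noteq> {}" "T \<noteq> P" using card m T by auto
  obtain u w where uw: "u \<in> T" "w \<in> P - T" "cut P u w (T - {u})"
    using cut_next[OF gp fin c2(1) g T(1) c2(2,3) sep] by blast
  have cT: "card (T - {u}) = m - 1" using uw T by simp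
  define e where "e = (\<lambda>(c, j). {p c j, p (nxt c) (m - 1 - j)})"
  have "inj_on e (UNIV \<times> {..<m})"
  proof (rule inj_onI, clarify)
    fix c d i j assume "i < m" "j < m" "e (c, i) = e (d, j)"
    then show "c = d \<and> i = j"
      using ladder_inj[OF lad] nxt_neq by (auto simp: e_def doubleton_eq_iff)
  qed
  then have "card (e ` (UNIV \<times> {..<m})) = 3 * m" by (simp add: card_image card_UNIV_color)
  moreover have "e ` (UNIV \<times> {..<m}) \<subseteq> k_edges P (m - 1)"
  proof clarify
    fix c j assume j: "j < m"
    then have jm: "j + (m - 1 - j) < m" "j \<le> m" "m - 1 - j \<le> m" by auto
    show "e (c, j) \<in> k_edges P (m - 1)"
      using cut_k_edge[OF ladder_cut[OF lad jm(1), of c] fin c2(1)] card_ladder_Un[OF lad jm(2,3), of c] j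
      by (simp add: e_def)
  qed
  ultimately have "e ` (UNIV \<times> {..<m}) = k_edges P (m - 1)"
    using E by (intro card_subset_eq[OF finite_k_edges[OF fin]]) auto
  moreover have "{u, w} \<in> k_edges P (m - 1)" using cut_k_edge[OF uw(3) fin c2(1)] cT by simp
  ultimately obtain r where r: "r \<in> UNIV \<times> {..<m}" "{u, w} = e r" by blast
  obtain c j where "r = (c, j)" by (cases r)
  with r have j: "j < m" "{u, w} = e (c, j)" by auto
  define l where "l = m - 1 - j"
  have jl: "j + l < m" "j + Suc l = m" "j \<le> m" "l \<le> m" using j by (auto simp: l_def)
  let ?S = "p c ` {..<j} \<union> p (nxt c) ` {..<l}"
  have uw': "u = p c j \<and> w = p (nxt c) l \<or> u = p (nxt c) l \<and> w = p c j"
    using j(2) by (simp add: e_def l_def doubleton_eq_iff)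
  have "T - {u} = ?S"
  proof (rule cut_unique[OF fin])
    show "cut P (p c j) (p (nxt c) l) (T - {u})" using uw' uw(3) by (auto simp: cut_sym)
    show "cut P (p c j) (p (nxt c) l) ?S" by (rule ladder_cut[OF lad jl(1)])
    show "card (T - {u}) + card ?S + 2 < card P"
      using cT card_ladder_Un[OF lad jl(3,4), of c] jl card by simp
  qed
  then have T': "T = insert u ?S" using uw by auto
  from uw' show ?thesis
  proof
    assume "u = p c j \<and> w = p (nxt c) l"
    then show ?thesis using that[of "Suc j" l c] jl T' by (simp add: lessThan_Suc)
  next
    assume "u = p (nxt c) l \<and> w = p c j"
    then show ?thesis using that[of j "Suc l" c] jl T' by (simp add: lessThan_Suc)
  qed
qed

text \<open>Take the functional of the edge where the class \<open>nxt c\<close> begins to replace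
  the class \<open>c\<close>, and perturb it so that all values differ and the old point comes
  first. Then the class \<open>c\<close> forms the first \<open>m\<close> points, and it remains to
  show that the last \<open>m\<close> are the third class.\<close>

lemma ladder_direction:
  assumes gp: "general_position P" and fin: "finite P" and card: "card P = 3 * m"
    and lad: "ladder P m p" and E: "card (k_edges P (m - 1)) = 3 * m" and m: "0 < m"
  obtains d where "\<And>x y. x \<in> p c ` {..<m} \<Longrightarrow> y \<in> p (nxt c) ` {..<m} \<Longrightarrow> x \<bullet> d < y \<bullet> d"
    "\<And>y z. y \<in> p (nxt c) ` {..<m} \<Longrightarrow> z \<in> p (nxt (nxt c)) ` {..<m} \<Longrightarrow> y \<bullet> d < z \<bullet> d"
proof -
  obtain k where k: "m = Suc k" using m by (cases m) auto
  let ?A = "p c ` {..<m}" and ?C = "p (nxt (nxt c)) ` {..<m}"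
  let ?a = "p c k" and ?b = "p (nxt c) 0" and ?z = "p (nxt (nxt c)) k"
  have "cut P ?a ?b (p c ` {..<k})" using ladder_cut[OF lad, of k 0 c] k by simp
  then obtain f where ab: "?a \<in> P" "?b \<in> P" "?a \<noteq> ?b" and
    f: "affine_fun f" "f ?a = 0" "f ?b = 0" "\<And>s. s \<in> p c ` {..<k} \<Longrightarrow> f s < 0"
    "\<And>q. q \<in> P - p c ` {..<k} - {?a, ?b} \<Longrightarrow> 0 < f q"
    unfolding cut_def by metis
  have A: "?A = insert ?a (p c ` {..<k})" using k by (simp add: lessThan_Suc)
  have AP: "?A \<subseteq> P" using ladder_in[OF lad] by auto
  have cA: "card ?A = m" by (rule card_ladder_image[OF lad]) simp
  obtain d0 where d0: "inj_on (\<lambda>x. x \<bullet> d0) P" using injective_direction[OF fin] .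
  then have "?a \<bullet> d0 \<noteq> ?b \<bullet> d0" using ab by (metis inj_onD)
  define d1 where "d1 = (if ?a \<bullet> d0 < ?b \<bullet> d0 then d0 else - d0)"
  have d1: "inj_on (\<lambda>x. x \<bullet> d1) P" "?a \<bullet> d1 < ?b \<bullet> d1"
    using d0 \<open>?a \<bullet> d0 \<noteq> ?b \<bullet> d0\<close> by (auto simp: d1_def inj_on_def)
  obtain e where e: "0 < e" "\<And>x y. x \<in> P \<Longrightarrow> y \<in> P \<Longrightarrow> f x < f y \<Longrightarrow> f x + e * (x \<bullet> d1) < f y + e * (y \<bullet> d1)"
    using generic_perturbation[OF fin, of f "\<lambda>x. x \<bullet> d1"] by metis
  define g where "g x = f x + e * (x \<bullet> d1)" for x
  have gmono: "g x < g y" if "x \<in> P" "y \<in> P" "f x < f y" for x y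
    using e(2)[OF that] by (simp add: g_def)
  have ginj: "inj_on g P"
  proof (rule inj_onI)
    fix x y assume xy: "x \<in> P" "y \<in> P" "g x = g y"
    then have "f x = f y" using gmono[of x y] gmono[of y x] by fastforce
    then have "x \<bullet> d1 = y \<bullet> d1" using xy(3) e(1) by (simp add: g_def)
    then show "x = y" using d1(1) xy by (metis inj_onD)
  qed
  have gab: "g ?a < g ?b" using f d1 e by (simp add: g_def)
  have "affine_fun (\<lambda>x. 1 * f x + e * (x \<bullet> d1 + 0) + 0)" 
    by (intro affine_fun_comb f affine_fun_inner)
  then have ag: "affine_fun g" by (simp add: g_def[abs_def])
  have AY: "g a < g y" if "a \<in> ?A" "y \<in> P - ?A" for a y
  proof -
    have y: "y = ?b \<or> 0 < f y" using f(5)[of y] that(2) A by auto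
    have a: "a = ?a \<or> f a < 0" using f(4)[of a] that(1) A by auto
    have "a \<in> P" "y \<in> P" using that AP by auto
    then show ?thesis using gmono[of a y] gab y a f(2,3) by fastforce
  qed
  obtain T where T: "T \<subseteq> P" "card T = m" "\<forall>s\<in>T. \<forall>q\<in>P - T. g q < g s"
    using top_subset[OF fin ginj, of m] card by auto
  \<comment> \<open>A point of the first class in \<open>T\<close> would force all
    \<open>2 * m\<close> points outside that class into \<open>T\<close>.\<close>
  have TA: "T \<inter> ?A = {}"
  proof (rule ccontr)
    assume "T \<inter> ?A \<noteq> {}"
    then obtain a where a: "a \<in> T" "a \<in> ?A" by blast
    have "P - ?A \<subseteq> T" using AY[OF a(2)] T(3) a(1) by (force dest: less_asym)
    then have "card (P - ?A) \<le> m" using T(1,2) fin card_mono finite_subset by metis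
    then show False using AP cA card m fin by (simp add: card_Diff_subset)
  qed
  have "affine_fun (\<lambda>x. (- 1) * g x + 0 * g x + 0)" by (intro affine_fun_comb ag)
  then have "affine_fun (\<lambda>x. - g x)" by simp
  then obtain c' j l where jl: "j + l = m" "T = p c' ` {..<j} \<union> p (nxt c') ` {..<l}"
    by (rule ladder_level_set[OF gp fin card lad E m _ T(1,2)]) (use T(3) in auto)
  have z: "?z \<in> P" "0 < f ?z"
  proof -
    show "?z \<in> P" using ladder_in[OF lad] k by simp
    moreover have "?z \<notin> p c ` {..<k}" "?z \<noteq> ?a" "?z \<noteq> ?b"
      using ladder_inj[OF lad] k by auto
    ultimately show "0 < f ?z" using f(5) by blast
  qed
  \<comment> \<open>\<open>?b\<close> is the first point of the second class and \<open>?z\<close>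
    the last of the third. That \<open>T\<close> cannot contain \<open>?b\<close> without
    \<open>?z\<close> rules out the second class and its mixtures with the third.\<close>
  have bz: "?z \<in> T" if "?b \<in> T"
    using gmono[OF ab(2) z(1)] f(3) z T(3) that by (force dest: less_asym)
  have memT: "p d i \<in> T \<longleftrightarrow> d = c' \<and> i < j \<or> d = nxt c' \<and> i < l" if "i < m" for d i
    using jl that ladder_inj[OF lad] by (auto simp: image_iff)
  have notA: "p c i \<notin> T" if "i < m" for i using TA that by blast
  have "T = ?C"
  proof -
    consider "c' = c" | "c' = nxt c" | "c' = nxt (nxt c)" using color_cases by blast
    then show ?thesis
    proof cases
      case 1
      then have "j = 0" using notA[of 0] memT[of 0 c] m by auto
      then have "?b \<in> T" "?z \<notin> T" using memT 1 jl(1) k by auto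
      then show ?thesis using bz by blast
    next
      case 2
      then have "0 < j \<Longrightarrow> ?b \<in> T" "0 < j \<Longrightarrow> ?z \<notin> T" using memT jl(1) k by auto
      then have "j = 0" using bz by blast
      then show ?thesis using jl 2 by simp
    next
      case 3
      then have "l = 0" using notA[of 0] memT[of 0 c] m by auto
      then show ?thesis using jl 3 by simp
    qed
  qed
  obtain d r where g: "\<And>x. g x = x \<bullet> d + r" using ag unfolding affine_fun_def by metis
  have B: "y \<in> P - ?A" "y \<in> P - ?C" if "y \<in> p (nxt c) ` {..<m}" for y
    using that ladder_inj[OF lad] ladder_in[OF lad] by auto
  show ?thesis
  proof (rule that[of d])
    show "x \<bullet> d < y \<bullet> d" if "x \<in> ?A" "y \<in> p (nxt c) ` {..<m}" for x y
      using AY[OF that(1) B(1)[OF that(2)]] by (simp add: g)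
    show "y \<bullet> d < z \<bullet> d" if "y \<in> p (nxt c) ` {..<m}" "z \<in> ?C" for y z
    proof -
      have "g y < g z" using T(3) B(2)[OF that(1)] that(2) \<open>T = ?C\<close> by blast
      then show ?thesis by (simp add: g)
    qed
  qed
qed

subsection \<open>The enclosing triangle\<close>

lemma between_along_scaleR:
  assumes "between_along d A B C" "r \<noteq> 0"
  shows "between_along (r *\<^sub>R d) A B C"
proof (cases "r > 0")
  case True
  then show ?thesis using assms by (simp add: between_along_def)
next
  case False
  then have "r < 0" using assms by simp
  then show ?thesis using assms(1) by (simp add: between_along_def mult_less_cancel_left_neg) blast
qed

text \<open>Vectors with sum zero are the sides of a triangle. Centred at the origin and scaled by a
  large \<open>R\<close>, it encloses the finite set.\<close>

lemma enclosing_triangle: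
  fixes v1 v2 v3 :: point
  assumes fin: "finite P" and sum: "v1 + v2 + v3 = 0" and D0: "orient 0 v1 v2 \<noteq> 0"
  obtains t1 t2 t3 R where "0 < R" "t2 - t1 = R *\<^sub>R v1" "t3 - t2 = R *\<^sub>R v2" "t1 - t3 = R *\<^sub>R v3"
    "orient t1 t2 t3 \<noteq> 0" "P \<subseteq> convex hull {t1, t2, t3}"
proof -
  define D where "D = orient 0 v1 v2"
  \<comment> \<open>Relative to the centroid 0 of the triangle, \<open>1 / 3 + L v x / R\<close> is the barycentric coordinate of \<open>x\<close>
    at the vertex opposite to the side of direction \<open>v\<close>.\<close>
  define L where "L v x = - orient 0 x v / D" for v x :: point
  \<comment> \<open>Large enough to make all three barycentric coordinates nonnegative at every
    point of \<open>P\<close>; the summand 1 keeps \<open>R\<close> positive.\<close>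
  define R where "R = 1 + (\<Sum>x\<in>P. 3 * (\<bar>L v1 x\<bar> + \<bar>L v2 x\<bar> + \<bar>L v3 x\<bar>))"
  have D: "D = fst v1 * snd v2 - snd v1 * fst v2" "D \<noteq> 0"
    using D0 by (simp_all add: D_def orient_def)
  have v3: "v3 = - v1 - v2" using sum by (auto simp: prod_eq_iff)
  define t1 where "t1 = (R / 3) *\<^sub>R (v3 - v1)"
  define t2 where "t2 = (R / 3) *\<^sub>R (v1 - v2)"
  define t3 where "t3 = (R / 3) *\<^sub>R (v2 - v3)"
  have "0 \<le> (\<Sum>x\<in>P. 3 * (\<bar>L v1 x\<bar> + \<bar>L v2 x\<bar> + \<bar>L v3 x\<bar>))" by (rule sum_nonneg) simp
  then have R: "0 < R" by (simp add: R_def)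
  have bound: "3 * (\<bar>L v1 x\<bar> + \<bar>L v2 x\<bar> + \<bar>L v3 x\<bar>) \<le> R" if "x \<in> P" for x
    using member_le_sum[OF that, of "\<lambda>x. 3 * (\<bar>L v1 x\<bar> + \<bar>L v2 x\<bar> + \<bar>L v3 x\<bar>)"] fin
    by (simp add: R_def)
  have t: "t2 - t1 = R *\<^sub>R v1" "t3 - t2 = R *\<^sub>R v2" "t1 - t3 = R *\<^sub>R v3"
    by (simp_all add: t1_def t2_def t3_def v3 prod_eq_iff algebra_simps)
  have "orient t1 t2 t3 = R\<^sup>2 * D"
    by (simp add: orient_def t1_def t2_def t3_def v3 D field_simps power2_eq_square)
  then have o: "orient t1 t2 t3 \<noteq> 0" using R D by simp
  have "x \<in> convex hull {t1, t2, t3}" if x: "x \<in> P" for x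
  proof -
    define a where "a v = 1 / 3 + L v x / R" for v
    have nn: "0 \<le> a v" if "v \<in> {v1, v2, v3}" for v
    proof -
      have "- R \<le> 3 * L v x" using bound[OF x] that by auto
      then show ?thesis using R by (simp add: a_def field_simps)
    qed
    have L0: "L v1 x + L v2 x + L v3 x = 0"
      by (simp add: L_def v3 orient_def diff_divide_distrib add_divide_distrib algebra_simps)
    have "a v1 + a v2 + a v3 = 1 + (L v1 x + L v2 x + L v3 x) / R"
      by (simp add: a_def add_divide_distrib)
    then have s1: "a v1 + a v2 + a v3 = 1" using L0 by simp
    have aR: "(a v * R) = R / 3 + L v x" for v using R by (simp add: a_def field_simps)
    have LD: "L v x * D = - (fst x * snd v - snd x * fst v)" for v
      using D by (simp add: L_def orient_def)
    \<comment> \<open>\<open>?y\<close> is the part of the barycentric combination that is linear in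
      \<open>x\<close>; the constant part vanishes because the vertices sum to 0. Multiplying by
      \<open>D\<close> clears the denominators of \<open>L\<close>.\<close>
    let ?y = "L v2 x *\<^sub>R ((v3 - v1) /\<^sub>R 3) + L v3 x *\<^sub>R ((v1 - v2) /\<^sub>R 3) + L v1 x *\<^sub>R ((v2 - v3) /\<^sub>R 3)"
    have "D *\<^sub>R x = D *\<^sub>R ?y"
    proof (rule prod_eqI)
      have "fst (D *\<^sub>R ?y) = ((L v2 x * D) * (fst v3 - fst v1) + (L v3 x * D) * (fst v1 - fst v2) +
          (L v1 x * D) * (fst v2 - fst v3)) / 3"
        by (simp add: algebra_simps add_divide_distrib diff_divide_distrib)
      also have "\<dots> = D * fst x"
        unfolding LD by (simp add: D v3 algebra_simps add_divide_distrib diff_divide_distrib)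
      finally show "fst (D *\<^sub>R x) = fst (D *\<^sub>R ?y)" by (simp only: fst_scaleR real_scaleR_def)
    next
      have "snd (D *\<^sub>R ?y) = ((L v2 x * D) * (snd v3 - snd v1) + (L v3 x * D) * (snd v1 - snd v2) +
          (L v1 x * D) * (snd v2 - snd v3)) / 3"
        by (simp add: algebra_simps add_divide_distrib diff_divide_distrib)
      also have "\<dots> = D * snd x"
        unfolding LD by (simp add: D v3 algebra_simps add_divide_distrib diff_divide_distrib)
      finally show "snd (D *\<^sub>R x) = snd (D *\<^sub>R ?y)" by (simp only: snd_scaleR real_scaleR_def)
    qed
    then have x': "x = ?y"
      using D by (metis scaleR_cancel_left)
    have "a v2 *\<^sub>R t1 + a v3 *\<^sub>R t2 + a v1 *\<^sub>R t3 =
       (a v2 * R) *\<^sub>R ((v3 - v1) /\<^sub>R 3) + (a v3 * R) *\<^sub>R ((v1 - v2) /\<^sub>R 3) + (a v1 * R) *\<^sub>R ((v2 - v3) /\<^sub>R 3)"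
      by (simp only: t1_def t2_def t3_def scaleR_scaleR mult.assoc divide_inverse)
    also have "\<dots> = (R / 3) *\<^sub>R ((v3 - v1) /\<^sub>R 3 + (v1 - v2) /\<^sub>R 3 + (v2 - v3) /\<^sub>R 3) + ?y"
      unfolding aR by (simp only: scaleR_left_distrib scaleR_right_distrib add_ac)
    also have "(v3 - v1) /\<^sub>R 3 + (v1 - v2) /\<^sub>R 3 + (v2 - v3) /\<^sub>R 3 = 0"
      by (simp flip: scaleR_right_distrib)
    also have "(R / 3) *\<^sub>R 0 + ?y = x" using x' by simp
    finally have "x = a v2 *\<^sub>R t1 + a v3 *\<^sub>R t2 + a v1 *\<^sub>R t3" ..
    moreover have "0 \<le> a v1" "0 \<le> a v2" "0 \<le> a v3" using nn by auto
    moreover have "a v2 + a v3 + a v1 = 1" using s1 by simp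
    ultimately show ?thesis unfolding convex_hull_3 by blast
  qed
  then show ?thesis using that[OF R t o] by blast
qed

text \<open>Parallel directions would order the three points equally or in reverse, hence with the
  same middle point; here it is \<open>a\<close> for \<open>d\<close> and \<open>b\<close> for
  \<open>e\<close>.\<close>

lemma nonparallel_directions:
  fixes d e :: point
  assumes "c \<bullet> d < a \<bullet> d" "a \<bullet> d < b \<bullet> d" "a \<bullet> e < b \<bullet> e" "b \<bullet> e < c \<bullet> e"
  shows "orient 0 d e \<noteq> 0"
proof
  assume "orient 0 d e = 0"
  then have par: "fst d * snd e = snd d * fst e" by (simp add: orient_def)
  have "d \<bullet> d * (x \<bullet> e) - d \<bullet> e * (x \<bullet> d) =
      (fst x * snd d - snd x * fst d) * (snd d * fst e - fst d * snd e)" for x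
    by (simp add: inner_prod_def algebra_simps)
  then have eq: "d \<bullet> d * (x \<bullet> e) = d \<bullet> e * (x \<bullet> d)" for x by (simp add: par)
  have "d \<noteq> 0" using assms(1) by auto
  then have dd: "0 < d \<bullet> d" by simp
  have "d \<bullet> d * (a \<bullet> e) < d \<bullet> d * (b \<bullet> e)" "d \<bullet> d * (b \<bullet> e) < d \<bullet> d * (c \<bullet> e)"
    using assms(3,4) dd by simp_all
  then have "d \<bullet> e * (a \<bullet> d) < d \<bullet> e * (b \<bullet> d)" "d \<bullet> e * (b \<bullet> d) < d \<bullet> e * (c \<bullet> d)"
    by (simp_all only: eq)
  then have "0 < d \<bullet> e" "d \<bullet> e < 0"
    using assms(1,2) by (auto simp: mult_less_cancel_left)
  then show False by simp
qed

section \<open>Assembling the decomposition\<close>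

theorem theorem1:
  fixes P :: "point set" and n :: nat
  assumes "finite P" and "card P = n" and "n > 0" and "3 dvd n"
    and "general_position P"
    and "\<forall>k::nat. 3 * k < n \<longrightarrow> E_le P k = 3 * ((k + 2) choose 2)"
  shows "three_decomposable P"
proof -
  obtain m where n: "n = 3 * m" using assms(4) by (rule dvdE)
  have fin: "finite P" and gp: "general_position P" and card: "card P = 3 * m" and m: "0 < m"
    using assms n by auto
  \<comment> \<open>By Pascal's rule the binomials for \<open>k\<close> and \<open>k - 1\<close>
    differ by \<open>k + 1\<close>, which turns the cumulative counts into exact ones.\<close>
  have E: "card (k_edges P k) = 3 * (k + 1)" if k: "k < m" for k
  proof (cases k)
    case 0
    then show ?thesis using assms(6)[rule_format, of 0] m n by (simp add: E_le_def E_def numeral_2_eq_2)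
  next
    case (Suc j)
    have "E_le P k = E_le P j + E P k" by (simp add: E_le_def Suc)
    moreover have "E_le P k = 3 * ((k + 2) choose 2)" "E_le P j = 3 * ((j + 2) choose 2)"
      using assms(6) k n Suc by auto
    moreover have "(k + 2) choose 2 = (k + 1) + ((j + 2) choose 2)"
      by (simp add: Suc numeral_2_eq_2)
    ultimately show ?thesis by (simp add: E_def)
  qed
  obtain p where lad: "ladder P m p" using ladder_exists[OF gp fin card E m] by blast
  have Em: "card (k_edges P (m - 1)) = 3 * m" using E[of "m - 1"] m by simp
  have "\<exists>d. (\<forall>x\<in>p c ` {..<m}. \<forall>y\<in>p (nxt c) ` {..<m}. x \<bullet> d < y \<bullet> d) \<and>
      (\<forall>y\<in>p (nxt c) ` {..<m}. \<forall>z\<in>p (nxt (nxt c)) ` {..<m}. y \<bullet> d < z \<bullet> d)" for c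
    by (rule ladder_direction[OF gp fin card lad Em m, of c]) blast
  then obtain d where d:
    "\<And>c. \<forall>x\<in>p c ` {..<m}. \<forall>y\<in>p (nxt c) ` {..<m}. x \<bullet> d c < y \<bullet> d c"
    "\<And>c. \<forall>y\<in>p (nxt c) ` {..<m}. \<forall>z\<in>p (nxt (nxt c)) ` {..<m}. y \<bullet> d c < z \<bullet> d c"
    by metis
  define A where "A = p Red ` {..<m}"
  define B where "B = p Green ` {..<m}"
  define C where "C = p Blue ` {..<m}"
  note ABC = A_def B_def C_def
  have cards: "card A = m" "card B = m" "card C = m"
    using card_ladder_image[OF lad] by (simp_all add: ABC)
  have disj: "A \<inter> B = {}" "B \<inter> C = {}" "A \<inter> C = {}"
    using ladder_inj[OF lad] by (auto simp: ABC)
  have "card (A \<union> B \<union> C) = 3 * m"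
    using cards disj by (simp add: card_Un_disjoint Int_Un_distrib2 ABC)
  moreover have "A \<union> B \<union> C \<subseteq> P" using ladder_in[OF lad] by (auto simp: ABC)
  ultimately have un: "A \<union> B \<union> C = P" using card fin by (intro card_subset_eq) auto
  \<comment> \<open>The direction \<open>d c\<close> has the class \<open>nxt c\<close> in the
    middle, so the side with \<open>A\<close> (red) in the middle takes
    \<open>d Blue\<close>.\<close>
  define d1 where "d1 = d Blue"
  define d2 where "d2 = d Red"
  define d3 where "d3 = d Green"
  have betw: "between_along d1 A B C" "between_along d2 B C A" "between_along d3 C A B"
    using d[of Blue] d[of Red] d[of Green] by (auto simp: between_along_def ABC d1_def d2_def d3_def)
  have nz: "orient 0 (d c) (d (nxt c)) \<noteq> 0" for c
    using d(1)[of c] d(2)[of c] d(1)[of "nxt c"] d(2)[of "nxt c"] m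
    by (intro nonparallel_directions[of "p c 0" _ "p (nxt c) 0" "p (nxt (nxt c)) 0"]) auto
  \<comment> \<open>By Cramer's rule, three plane vectors weighted with the determinants of the
    other two, taken cyclically, sum to 0, so the scaled directions close up to a triangle. A
    negative factor merely reverses the order along its side.\<close>
  define v1 where "v1 = orient 0 d2 d3 *\<^sub>R d1"
  define v2 where "v2 = orient 0 d3 d1 *\<^sub>R d2"
  define v3 where "v3 = orient 0 d1 d2 *\<^sub>R d3"
  have det: "orient 0 d2 d3 \<noteq> 0" "orient 0 d3 d1 \<noteq> 0" "orient 0 d1 d2 \<noteq> 0"
    using nz[of Blue] nz[of Red] nz[of Green] by (simp_all add: d1_def d2_def d3_def)
  have "v1 + v2 + v3 = 0"
    by (simp add: v1_def v2_def v3_def orient_def prod_eq_iff algebra_simps)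
  moreover have "orient 0 v1 v2 = orient 0 d2 d3 * orient 0 d3 d1 * orient 0 d1 d2"
    by (simp add: v1_def v2_def orient_def algebra_simps)
  then have "orient 0 v1 v2 \<noteq> 0" using det by simp
  ultimately obtain t1 t2 t3 R where t: "0 < R" "t2 - t1 = R *\<^sub>R v1" "t3 - t2 = R *\<^sub>R v2"
    "t1 - t3 = R *\<^sub>R v3" "orient t1 t2 t3 \<noteq> 0" "P \<subseteq> convex hull {t1, t2, t3}"
    using enclosing_triangle[OF fin] by metis
  have "between_along (t2 - t1) A B C" "between_along (t3 - t2) B C A" "between_along (t1 - t3) C A B"
    unfolding t(2-4) v1_def v2_def v3_def using betw det t(1)
    by (simp_all add: between_along_scaleR)
  then show ?thesis unfolding three_decomposable_def using un disj cards t by metis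
qed

end
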